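(* Let $a_c>b_c>0$, $k_e>0$, $a_e^2=a_c^2+k_e$, $b_e^2=b_c^2+k_e$, let $c$ be the ellipse $x^2/a_c^2+y^2/b_c^2=1$ and $e$ the ellipse $x^2/a_e^2+y^2/b_e^2=1$. Let $\dots P_0P_1P_2\dots$ be a billiard in $e$ with caustic $c$, whose side $[P_i,P_{i+1}]$ touches $c$ at $Q_i$ ($i\in\mathbb Z$). For $i\in\mathbb Z$ and $j=1,2,\dots$ define the points (in the real projective plane) $$S_i^{(j)}=\begin{cases}[P_{i-k-1},P_{i-k}]\cap[P_{i+k},P_{i+k+1}] & \text{if } j=2k,\\ [P_{i-k},P_{i-k+1}]\cap[P_{i+k},P_{i+k+1}] & \text{if } j=2k-1.\end{cases}$$ Then: (1) The points $S_i^{(1)},S_i^{(3)},\dots$ lie on the hyperbola of the confocal family through $Q_i$, and the points $S_i^{(2)},S_i^{(4)},\dots$ lie on the hyperbola of the confocal family through $P_i$. (2) For each $j\in\{1,2,\dots\}$ there is a member $e^{(j)}$ of the confocal family, or a degenerate limit of it (one of the two coordinate axes or the line at infinity), containing all points $S_i^{(j)}$, $i\in\mathbb Z$; if $e^{(j)}$ is a regular (ellipse) member, then the points $\dots,S_i^{(j)},S_{i+(j+1)}^{(j)},S_{i+2(j+1)}^{(j)},\dots$ are the consecutive vertices of a billiard in the ellipse $e^{(j)}$ with caustic $c$. The conic $e^{(j)}$ does not depend on the choice of the billiard in $e$ with caustic $c$ (i.e. on the position of the initial vertex $P_0\in e$), but only on $e$, $c$ and $j$.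
   Context: The confocal family is $x^2/(a_c^2+k)+y^2/(b_c^2+k)=1$, $k\in\mathbb R\setminus\{-a_c^2,-b_c^2\}$, consisting of ellipses for $k>-b_c^2$ and hyperbolas for $-a_c^2<k<-b_c^2$; $c$ is the member $k=0$ and $e$ the member $k=k_e$. A billiard in an ellipse $E$ of the family with caustic $c$ (where $c$ lies inside $E$) is a sequence $(P_i)_{i\in\mathbb Z}$ of points of $E$ with $P_{i+1}\neq P_i$ such that every line $[P_i,P_{i+1}]$ is tangent to $c$ and $[P_{i-1},P_i]\neq[P_i,P_{i+1}]$, i.e. the two sides at each vertex are the two tangents from it to $c$. *)

theory Defs
  imports Main Complex_Main
begin

text \<open>Affine points of the real plane and homogeneous coordinates of the real
projective plane (a projective point is represented by any nonzero triple).\<close>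

type_synonym pt = "real \<times> real"
type_synonym hpt = "real \<times> real \<times> real"

text \<open>The confocal family with parameters a, b (a > b > 0):
  x^2/(a^2+k) + y^2/(b^2+k) = 1.  Affine member (k not in {-a^2,-b^2}).\<close>
definition conf :: "real \<Rightarrow> real \<Rightarrow> real \<Rightarrow> pt set" where
  "conf a b k = {(x, y). x\<^sup>2 / (a\<^sup>2 + k) + y\<^sup>2 / (b\<^sup>2 + k) = 1}"

text \<open>Projective closure of the members, written without denominators:
  (b^2+k) x^2 + (a^2+k) y^2 = (a^2+k)(b^2+k) z^2.  For k = -b^2 this is the
  x-axis (y = 0), for k = -a^2 the y-axis (x = 0).  The limit k = infinity,
  the line at infinity z = 0, is encoded by None.\<close>
fun on_gconic :: "real \<Rightarrow> real \<Rightarrow> real option \<Rightarrow> hpt \<Rightarrow> bool" where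
  "on_gconic a b (Some k) (x, y, z) \<longleftrightarrow>
     (b\<^sup>2 + k) * x\<^sup>2 + (a\<^sup>2 + k) * y\<^sup>2 = (a\<^sup>2 + k) * (b\<^sup>2 + k) * z\<^sup>2"
| "on_gconic a b None (x, y, z) \<longleftrightarrow> z = 0"

text \<open>Admissible generalized members: real members (k > -a^2, k \<noteq> -b^2),
  the two axes (k = -a^2, k = -b^2) and the line at infinity (None).\<close>
definition admissible :: "real \<Rightarrow> real option \<Rightarrow> bool" where
  "admissible a E \<longleftrightarrow> E = None \<or> (\<exists>k. E = Some k \<and> - (a\<^sup>2) \<le> k)"

definition hom :: "pt \<Rightarrow> hpt" where
  "hom p = (fst p, snd p, 1)"

definition dehom :: "hpt \<Rightarrow> pt" where
  "dehom p = (fst p / snd (snd p), fst (snd p) / snd (snd p))"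

definition cross :: "hpt \<Rightarrow> hpt \<Rightarrow> hpt" where
  "cross u v = (case u of (u1, u2, u3) \<Rightarrow> case v of (v1, v2, v3) \<Rightarrow>
      (u2 * v3 - u3 * v2, u3 * v1 - u1 * v3, u1 * v2 - u2 * v1))"

definition hline :: "pt \<Rightarrow> pt \<Rightarrow> hpt" where
  "hline p q = cross (hom p) (hom q)"

definition meet :: "hpt \<Rightarrow> hpt \<Rightarrow> hpt" where
  "meet l m = cross l m"

definition aline :: "pt \<Rightarrow> pt \<Rightarrow> pt set" where
  "aline p q = {(fst p + t * (fst q - fst p), snd p + t * (snd q - snd p)) | t. True}"

definition tangent_to :: "pt set \<Rightarrow> pt \<Rightarrow> pt \<Rightarrow> bool" where
  "tangent_to C p q \<longleftrightarrow> (\<exists>!X. X \<in> C \<and> X \<in> aline p q)"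

definition billiard :: "real \<Rightarrow> real \<Rightarrow> real \<Rightarrow> (int \<Rightarrow> pt) \<Rightarrow> bool" where
  "billiard a b k P \<longleftrightarrow> 0 < k \<and>
     (\<forall>i. P i \<in> conf a b k) \<and>
     (\<forall>i. P (i + 1) \<noteq> P i) \<and>
     (\<forall>i. tangent_to (conf a b 0) (P i) (P (i + 1))) \<and>
     (\<forall>i. aline (P (i - 1)) (P i) \<noteq> aline (P i) (P (i + 1)))"

text \<open>S_i^(j) is the intersection of the sides [P_s, P_(s+1)] and [P_t, P_(t+1)]
  where (s,t) = (i-k-1, i+k) if j = 2k and (s,t) = (i-k, i+k) if j = 2k-1.\<close>
definition sfst :: "nat \<Rightarrow> int \<Rightarrow> int" where
  "sfst j i = (if even j then i - int (j div 2) - 1 else i - int ((j + 1) div 2))"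

definition ssnd :: "nat \<Rightarrow> int \<Rightarrow> int" where
  "ssnd j i = (if even j then i + int (j div 2) else i + int ((j + 1) div 2))"

definition Spt :: "(int \<Rightarrow> pt) \<Rightarrow> nat \<Rightarrow> int \<Rightarrow> hpt" where
  "Spt P j i = meet (hline (P (sfst j i)) (P (sfst j i + 1)))
                    (hline (P (ssnd j i)) (P (ssnd j i + 1)))"

definition Sdef :: "(int \<Rightarrow> pt) \<Rightarrow> nat \<Rightarrow> int \<Rightarrow> bool" where
  "Sdef P j i \<longleftrightarrow> aline (P (sfst j i)) (P (sfst j i + 1))
                   \<noteq> aline (P (ssnd j i)) (P (ssnd j i + 1))"

end

theory Submission
  imports "HOL-Algebra.Group" Defs
begin

text \<open>
  A tangent of the ellipse c touches it at a point (a s, b c) with s^2 + c^2 = 1. With the modulus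
  m = 1 - b^2/a^2 and d = sqrt (1 - m s^2), the triple (s, c, d) behaves like (sn t, cn t, dn t)
  for a canonical parameter t, so the tangents form an abelian group under the addition formulas of
  the Jacobi elliptic functions. The group laws are polynomial identities; no elliptic function is
  needed. The intersection of the tangents u and v lies on the confocal ellipse determined by
  u - v and on the confocal hyperbola determined by u + v, and an ellipse determines the difference
  up to sign. Hence the sides of a billiard form an arithmetic progression in this group, whose
  step is determined by e up to sign: S_i^(j) is the intersection of two tangents whose difference
  is j + 1 steps and whose sum does not depend on j within each parity class.
\<close>

subsection \<open>Arithmetic progressions in abelian groups\<close>

context comm_group
begin

lemma mult_div_cancel: "x \<in> carrier G \<Longrightarrow> y \<in> carrier G \<Longrightarrow> x \<otimes> (y \<otimes> inv x) = y"
  by (metis inv_closed m_comm m_assoc r_inv r_one)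

lemma div_mult_cancel: "x \<in> carrier G \<Longrightarrow> y \<in> carrier G \<Longrightarrow> x \<otimes> inv (x \<otimes> y) = inv y"
  by (simp add: inv_mult m_assoc[symmetric])

lemma arithmetic_progression:
  fixes u :: "int \<Rightarrow> 'a"
  assumes "\<And>i. u i \<in> carrier G" "d \<in> carrier G" "\<And>i. u (i + 1) = u i \<otimes> d"
  shows "u (i + n) = u i \<otimes> d [^] n"
proof (induction n rule: int_induct[where k = 0])
  case base
  then show ?case
    using assms(1) by simp
next
  case (step1 n)
  have "u (i + (n + 1)) = u i \<otimes> d [^] n \<otimes> d"
    using assms(3)[of "i + n"] step1 by (simp add: add.assoc)
  then show ?case
    using assms(1,2) by (simp add: int_pow_mult m_assoc)
next
  case (step2 n)
  have "u (i + (n - 1)) \<otimes> d = u i \<otimes> d [^] (n - 1) \<otimes> d"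
    using assms(3)[of "i + (n - 1)"] step2 assms(1,2)
    by (simp add: m_assoc flip: int_pow_mult[of d "n - 1" 1, simplified])
  then show ?case
    using assms(1,2) by simp
qed

text \<open>Moving one index up and the other down by the same amount leaves the sum of the two
  terms unchanged. This puts all points of one parity class on a single hyperbola.\<close>

lemma arithmetic_progression_sum:
  fixes u :: "int \<Rightarrow> 'a"
  assumes "\<And>i. u i \<in> carrier G" "d \<in> carrier G" "\<And>i. u (i + 1) = u i \<otimes> d"
    and "i + j = k + l"
  shows "u i \<otimes> u j = u k \<otimes> u l"
proof -
  have "u i = u k \<otimes> d [^] (i - k)" "u l = u j \<otimes> d [^] (l - j)"
    using arithmetic_progression[of u d, OF assms(1-3), of k "i - k"]
      arithmetic_progression[of u d, OF assms(1-3), of j "l - j"] by simp_all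
  moreover have "l - j = i - k"
    using assms(4) by simp
  ultimately show ?thesis
    using assms(1,2) by (simp add: m_ac)
qed

end

subsection \<open>The addition law of the Jacobi elliptic functions\<close>

definition jac_add :: "real \<Rightarrow> hpt \<Rightarrow> hpt \<Rightarrow> hpt" where
  "jac_add m = (\<lambda>(s, c, d) (s', c', d').
     ((s * c' * d' + s' * c * d) / (1 - m * s\<^sup>2 * s'\<^sup>2),
      (c * c' - s * s' * d * d') / (1 - m * s\<^sup>2 * s'\<^sup>2),
      (d * d' - m * s * s' * c * c') / (1 - m * s\<^sup>2 * s'\<^sup>2)))"

definition jac_neg :: "hpt \<Rightarrow> hpt" where
  "jac_neg = (\<lambda>(s, c, d). (- s, c, d))"

text \<open>For \<open>0 < m < 1\<close> the two quadric equations cut out a real curve with two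
  ovals, and \<open>0 < d\<close> selects the oval of the identity. There \<open>d\<close> is a
  function of \<open>s\<close>, so the elements correspond to the contact points on c.\<close>

definition jac :: "real \<Rightarrow> hpt monoid" where
  "jac m = \<lparr>carrier = {(s, c, d). s\<^sup>2 + c\<^sup>2 = 1 \<and> d\<^sup>2 + m * s\<^sup>2 = 1 \<and> 0 < d},
            mult = jac_add m, one = (0, 1, 1)\<rparr>"

abbreviation sn :: "hpt \<Rightarrow> real" where "sn u \<equiv> fst u"
abbreviation cn :: "hpt \<Rightarrow> real" where "cn u \<equiv> fst (snd u)"
abbreviation dn :: "hpt \<Rightarrow> real" where "dn u \<equiv> snd (snd u)"

locale jacobi =
  fixes m :: real
  assumes m_pos: "0 < m" and m_less: "m < 1"
begin

lemma mem_jac: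
  "u \<in> carrier (jac m) \<longleftrightarrow> (sn u)\<^sup>2 + (cn u)\<^sup>2 = 1 \<and> (dn u)\<^sup>2 + m * (sn u)\<^sup>2 = 1 \<and> 0 < dn u"
  by (cases u) (simp add: jac_def)

lemma mem_jac_triple:
  "(s, c, d) \<in> carrier (jac m) \<longleftrightarrow> s\<^sup>2 + c\<^sup>2 = 1 \<and> d\<^sup>2 + m * s\<^sup>2 = 1 \<and> 0 < d"
  by (simp add: jac_def)

text \<open>Both squares are at most 1 and m < 1, so the addition formulas never divide by zero and
  no point at infinity has to be adjoined to the group.\<close>

lemma denominator_pos:
  assumes "s\<^sup>2 + c\<^sup>2 = 1" and "s'\<^sup>2 + c'\<^sup>2 = (1::real)"
  shows "0 < 1 - m * s\<^sup>2 * s'\<^sup>2"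
proof -
  have "s\<^sup>2 \<le> 1" and "s'\<^sup>2 \<le> 1"
    using assms zero_le_power2[of c] zero_le_power2[of c'] by linarith+
  then have "s\<^sup>2 * s'\<^sup>2 \<le> 1"
    by (simp add: mult_le_one)
  then have "m * (s\<^sup>2 * s'\<^sup>2) \<le> m * 1"
    using m_pos by (intro mult_left_mono) auto
  then show ?thesis
    using m_less by (simp add: mult.assoc)
qed

text \<open>This keeps sums on the oval \<open>0 < d\<close>. From d^2 - m c^2 = 1 - m > 0 it
  follows that m |c c'| < d d', while |s s'| is at most 1.\<close>

lemma dn_numerator_pos:
  assumes "s\<^sup>2 + c\<^sup>2 = 1" "d\<^sup>2 + m * s\<^sup>2 = 1" "0 < d"
    and "s'\<^sup>2 + c'\<^sup>2 = 1" "d'\<^sup>2 + m * s'\<^sup>2 = 1" "0 < d'"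
  shows "0 < d * d' - m * s * s' * c * c'"
proof -
  have gap: "m * y\<^sup>2 < z\<^sup>2" "y\<^sup>2 \<le> 1" "x\<^sup>2 \<le> 1"
    if "x\<^sup>2 + y\<^sup>2 = 1" "z\<^sup>2 + m * x\<^sup>2 = 1" for x y z :: real
  proof -
    have "z\<^sup>2 - m * y\<^sup>2 = 1 - m"
      using that by algebra
    then show "m * y\<^sup>2 < z\<^sup>2"
      using m_less by simp
    show "y\<^sup>2 \<le> 1" "x\<^sup>2 \<le> 1"
      using that zero_le_power2[of x] zero_le_power2[of y] by linarith+
  qed
  have "(m * s * s' * c * c')\<^sup>2 = (s\<^sup>2 * s'\<^sup>2) * ((m * c\<^sup>2) * (m * c'\<^sup>2))"
    by algebra
  also have "\<dots> \<le> 1 * ((m * c\<^sup>2) * (m * c'\<^sup>2))"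
    using gap(3)[OF assms(1,2)] gap(3)[OF assms(4,5)] m_pos
    by (intro mult_right_mono mult_le_one) auto
  also have "\<dots> < d\<^sup>2 * d'\<^sup>2"
    using gap(1)[OF assms(1,2)] gap(1)[OF assms(4,5)] m_pos
    by (simp only: mult_1) (intro mult_strict_mono', auto)
  finally have "(m * s * s' * c * c')\<^sup>2 < (d * d')\<^sup>2"
    by (simp add: power_mult_distrib)
  then have "m * s * s' * c * c' < d * d'"
    by (rule power2_less_imp_less) (use assms in simp)
  then show ?thesis
    by simp
qed

lemma jac_add_closed:
  assumes "u \<in> carrier (jac m)" and "v \<in> carrier (jac m)"
  shows "jac_add m u v \<in> carrier (jac m)"
proof -
  obtain s c d s' c' d' where uv: "u = (s, c, d)" "v = (s', c', d')"
    by (metis prod_cases3)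
  note h = assms[unfolded uv mem_jac_triple]
  have D: "0 < 1 - m * s\<^sup>2 * s'\<^sup>2"
    using h denominator_pos by blast
  have 1: "(s * c' * d' + s' * c * d)\<^sup>2 + (c * c' - s * s' * d * d')\<^sup>2 = (1 - m * s\<^sup>2 * s'\<^sup>2)\<^sup>2"
    and 2: "(d * d' - m * s * s' * c * c')\<^sup>2 + m * (s * c' * d' + s' * c * d)\<^sup>2
             = (1 - m * s\<^sup>2 * s'\<^sup>2)\<^sup>2"
    using h by algebra+
  have 3: "0 < d * d' - m * s * s' * c * c'"
    using h dn_numerator_pos by blast
  show ?thesis
    using D 3 by (simp add: uv jac_add_def mem_jac_triple power_divide flip: add_divide_distrib)
      (simp add: 1 2)
qed

lemma jac_add_comm: "jac_add m u v = jac_add m v u"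
  by (cases u; cases v) (simp add: jac_add_def algebra_simps)

text \<open>Associativity adds a third element to a sum that is itself a fraction. Clearing the
  inner denominator leaves one division per coordinate, so that cross multiplication yields
  polynomial identities.\<close>

lemma jac_add_fraction:
  assumes "D \<noteq> 0"
  shows "jac_add m (S / D, C / D, N / D) (s, c, d) =
    ((S * c * d * D + s * C * N) / (D\<^sup>2 - m * S\<^sup>2 * s\<^sup>2),
     (C * c * D - S * s * N * d) / (D\<^sup>2 - m * S\<^sup>2 * s\<^sup>2),
     (N * d * D - m * S * s * C * c) / (D\<^sup>2 - m * S\<^sup>2 * s\<^sup>2))"
proof -
  have *: "1 - m * (S / D)\<^sup>2 * s\<^sup>2 = (D\<^sup>2 - m * S\<^sup>2 * s\<^sup>2) / D\<^sup>2"
    using assms by (simp add: field_simps)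
  have "S / D * c * d + s * (C / D) * (N / D) = (S * c * d * D + s * C * N) / D\<^sup>2"
    "C / D * c - S / D * s * (N / D) * d = (C * c * D - S * s * N * d) / D\<^sup>2"
    "N / D * d - m * (S / D) * s * (C / D) * c = (N * d * D - m * S * s * C * c) / D\<^sup>2"
    using assms by (simp_all add: field_simps power2_eq_square)
  then show ?thesis
    unfolding jac_add_def prod.case * using assms by simp
qed

text \<open>Together with commutativity, cyclic invariance is associativity.\<close>
lemma jac_add_rotate:
  assumes "u \<in> carrier (jac m)" "v \<in> carrier (jac m)" "w \<in> carrier (jac m)"
  shows "jac_add m (jac_add m u v) w = jac_add m (jac_add m v w) u"
proof -
  obtain s1 c1 d1 s2 c2 d2 s3 c3 d3 where
    uvw: "u = (s1, c1, d1)" "v = (s2, c2, d2)" "w = (s3, c3, d3)"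
    by (metis prod_cases3)
  note h = assms[unfolded uvw mem_jac_triple]
  let ?D12 = "1 - m * s1\<^sup>2 * s2\<^sup>2" and ?D23 = "1 - m * s2\<^sup>2 * s3\<^sup>2"
  let ?S12 = "s1 * c2 * d2 + s2 * c1 * d1" and ?S23 = "s2 * c3 * d3 + s3 * c2 * d2"
  let ?C12 = "c1 * c2 - s1 * s2 * d1 * d2" and ?C23 = "c2 * c3 - s2 * s3 * d2 * d3"
  let ?N12 = "d1 * d2 - m * s1 * s2 * c1 * c2" and ?N23 = "d2 * d3 - m * s2 * s3 * c2 * c3"
  have D: "?D12 > 0" "?D23 > 0"
    using h denominator_pos by blast+
  \<comment> \<open>The outer denominator times D^2. The inner sum lies on the unit circle again, so
    \<open>denominator_pos\<close> applies to it.\<close>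
  have pos: "0 < D\<^sup>2 - m * S\<^sup>2 * s\<^sup>2" if "0 < D" "(S / D)\<^sup>2 + (C / D)\<^sup>2 = 1" "s\<^sup>2 + c\<^sup>2 = 1"
    for D S C s c
  proof -
    have "0 < D\<^sup>2 * (1 - m * (S / D)\<^sup>2 * s\<^sup>2)"
      using that denominator_pos by simp
    also have "\<dots> = D\<^sup>2 - m * S\<^sup>2 * s\<^sup>2"
      using that(1) by (simp add: power_divide right_diff_distrib)
    finally show ?thesis .
  qed
  have "jac_add m u v \<in> carrier (jac m)" "jac_add m v w \<in> carrier (jac m)"
    using assms jac_add_closed by blast+
  then have E: "?D12\<^sup>2 - m * ?S12\<^sup>2 * s3\<^sup>2 > 0" "?D23\<^sup>2 - m * ?S23\<^sup>2 * s1\<^sup>2 > 0"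
    using D h pos by (auto simp: uvw jac_add_def mem_jac_triple)
  have
    "(?S12 * c3 * d3 * ?D12 + s3 * ?C12 * ?N12) * (?D23\<^sup>2 - m * ?S23\<^sup>2 * s1\<^sup>2)
      = (?S23 * c1 * d1 * ?D23 + s1 * ?C23 * ?N23) * (?D12\<^sup>2 - m * ?S12\<^sup>2 * s3\<^sup>2)"
    using h by algebra
  moreover have
    "(?C12 * c3 * ?D12 - ?S12 * s3 * ?N12 * d3) * (?D23\<^sup>2 - m * ?S23\<^sup>2 * s1\<^sup>2)
      = (?C23 * c1 * ?D23 - ?S23 * s1 * ?N23 * d1) * (?D12\<^sup>2 - m * ?S12\<^sup>2 * s3\<^sup>2)"
    using h by algebra
  moreover have
    "(?N12 * d3 * ?D12 - m * ?S12 * s3 * ?C12 * c3) * (?D23\<^sup>2 - m * ?S23\<^sup>2 * s1\<^sup>2)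
      = (?N23 * d1 * ?D23 - m * ?S23 * s1 * ?C23 * c1) * (?D12\<^sup>2 - m * ?S12\<^sup>2 * s3\<^sup>2)"
    using h by algebra
  moreover have "jac_add m u v = (?S12 / ?D12, ?C12 / ?D12, ?N12 / ?D12)"
    "jac_add m v w = (?S23 / ?D23, ?C23 / ?D23, ?N23 / ?D23)"
    by (simp_all add: uvw jac_add_def)
  ultimately show ?thesis
    using D E jac_add_fraction[of ?D12 ?S12 ?C12 ?N12 s3 c3 d3]
      jac_add_fraction[of ?D23 ?S23 ?C23 ?N23 s1 c1 d1]
    by (simp only: uvw prod.inject) (simp add: frac_eq_eq)
qed

lemma jac_neg_closed: "u \<in> carrier (jac m) \<Longrightarrow> jac_neg u \<in> carrier (jac m)"
  by (cases u) (simp add: jac_neg_def mem_jac_triple)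

lemma jac_add_neg:
  assumes "u \<in> carrier (jac m)"
  shows "jac_add m (jac_neg u) u = (0, 1, 1)"
proof -
  obtain s c d where u: "u = (s, c, d)"
    by (metis prod_cases3)
  note h = assms[unfolded u mem_jac_triple]
  have "0 < 1 - m * s\<^sup>2 * s\<^sup>2"
    using h denominator_pos by blast
  moreover have "c * c + s * s * d * d = 1 - m * s\<^sup>2 * s\<^sup>2"
    "d * d + m * s * s * c * c = 1 - m * s\<^sup>2 * s\<^sup>2"
    using h by algebra+
  ultimately show ?thesis
    by (simp add: u jac_add_def jac_neg_def)
qed

sublocale jac: comm_group "jac m"
proof (rule comm_groupI)
  fix u v w
  assume "u \<in> carrier (jac m)" "v \<in> carrier (jac m)" "w \<in> carrier (jac m)"
  then show "u \<otimes>\<^bsub>jac m\<^esub> v \<otimes>\<^bsub>jac m\<^esub> w = u \<otimes>\<^bsub>jac m\<^esub> (v \<otimes>\<^bsub>jac m\<^esub> w)"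
    by (simp add: jac_def jac_add_comm[of u] flip: jac_add_rotate)
next
  fix u assume u: "u \<in> carrier (jac m)"
  show "\<one>\<^bsub>jac m\<^esub> \<otimes>\<^bsub>jac m\<^esub> u = u"
    by (cases u) (simp add: jac_def jac_add_def)
  show "\<exists>v\<in>carrier (jac m). v \<otimes>\<^bsub>jac m\<^esub> u = \<one>\<^bsub>jac m\<^esub>"
    using jac_add_neg[OF u] jac_neg_closed[OF u]
    by (intro bexI[of _ "jac_neg u"]) (simp_all add: jac_def)
next
  fix u v assume "u \<in> carrier (jac m)" "v \<in> carrier (jac m)"
  then show "u \<otimes>\<^bsub>jac m\<^esub> v \<in> carrier (jac m)"
    using jac_add_closed by (simp add: jac_def)
next
  fix u v
  show "u \<otimes>\<^bsub>jac m\<^esub> v = v \<otimes>\<^bsub>jac m\<^esub> u"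
    using jac_add_comm by (simp add: jac_def)
qed (simp add: jac_def)

lemma inv_jac:
  assumes "u \<in> carrier (jac m)"
  shows "inv\<^bsub>jac m\<^esub> u = (- sn u, cn u, dn u)"
  using jac.inv_equality[of "jac_neg u" u] jac_add_neg[OF assms] jac_neg_closed[OF assms] assms
  by (cases u) (simp add: jac_def jac_neg_def)

text \<open>The sign condition \<open>0 < dn\<close> fixes the root in dn^2 = 1 - m sn^2. A tangent
  is thus determined by its contact point.\<close>

lemma jac_eqI:
  assumes "u \<in> carrier (jac m)" "v \<in> carrier (jac m)" "sn u = sn v" "cn u = cn v"
  shows "u = v"
proof -
  have "(dn u)\<^sup>2 = (dn v)\<^sup>2"
    using assms(1-3) unfolding mem_jac by algebra
  then have "dn u = dn v"
    using assms(1,2) by (simp add: mem_jac power2_eq_iff_nonneg)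
  then show ?thesis
    using assms by (simp add: prod_eq_iff)
qed

section \<open>Inequalities and the half period\<close>

lemma dn_sq: "u \<in> carrier (jac m) \<Longrightarrow> (dn u)\<^sup>2 = 1 - m + m * (cn u)\<^sup>2"
  unfolding mem_jac by algebra

lemma cn_dn_bounds:
  assumes "u \<in> carrier (jac m)"
  shows "\<bar>cn u\<bar> \<le> dn u" "dn u \<le> 1" "0 < dn u"
proof -
  have h: "(sn u)\<^sup>2 + (cn u)\<^sup>2 = 1" "(dn u)\<^sup>2 + m * (sn u)\<^sup>2 = 1"
    and pos: "0 < dn u"
    using assms by (simp_all add: mem_jac)
  have "(dn u)\<^sup>2 = (cn u)\<^sup>2 + (1 - m) * (sn u)\<^sup>2"
    using h by algebra
  then have "(cn u)\<^sup>2 \<le> (dn u)\<^sup>2"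
    using m_less by simp
  then show "\<bar>cn u\<bar> \<le> dn u"
    using pos abs_le_square_iff[of "cn u" "dn u"] by simp
  have "(dn u)\<^sup>2 \<le> 1\<^sup>2"
    using h(2) m_pos mult_nonneg_nonneg[of m "(sn u)\<^sup>2"] by (simp del: mult_nonneg_nonneg)
  then show "dn u \<le> 1"
    by (rule power2_le_imp_le) simp
  show "0 < dn u" by fact
qed

text \<open>The half period is (0, -1, 1). Putting dn = - cn into dn^2 = 1 - m + m cn^2 gives cn^2 =
  1, and cn = 1 would make dn negative.\<close>

lemma cn_dn_half_period:
  assumes "u \<in> carrier (jac m)"
  shows "cn u + dn u = 0 \<longleftrightarrow> cn u = - 1" "cn u = - 1 \<Longrightarrow> dn u = 1"
proof -
  have *: "(dn u)\<^sup>2 = 1 - m + m * (cn u)\<^sup>2" "0 < dn u"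
    using assms dn_sq cn_dn_bounds by auto
  show 1: "dn u = 1" if "cn u = - 1"
  proof -
    have "(dn u)\<^sup>2 = 1\<^sup>2"
      using * that by simp
    then show ?thesis
      using *(2) by (simp add: power2_eq_1_iff)
  qed
  have "(1 - m) * (cn u - 1) * (cn u + 1) = 0" if "cn u + dn u = 0"
    using that *(1) by algebra
  then show "cn u + dn u = 0 \<longleftrightarrow> cn u = - 1"
    using 1 m_less *(2) by auto
qed

section \<open>Chord identities and half arguments\<close>

lemma mult_jac:
  fixes u v :: hpt
  defines "D \<equiv> 1 - m * (sn u)\<^sup>2 * (sn v)\<^sup>2"
  shows "sn (u \<otimes>\<^bsub>jac m\<^esub> v) = (sn u * cn v * dn v + sn v * cn u * dn u) / D"
    "cn (u \<otimes>\<^bsub>jac m\<^esub> v) = (cn u * cn v - sn u * sn v * dn u * dn v) / D"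
    "dn (u \<otimes>\<^bsub>jac m\<^esub> v) = (dn u * dn v - m * sn u * sn v * cn u * cn v) / D"
  by (cases u; cases v; simp add: D_def jac_def jac_add_def)+

lemma sn_mult_denominator_pos:
  assumes "u \<in> carrier (jac m)" "v \<in> carrier (jac m)"
  shows "0 < 1 - m * (sn u)\<^sup>2 * (sn v)\<^sup>2"
  using assms denominator_pos unfolding mem_jac by blast

text \<open>After scaling c to the unit circle, the three squared terms belong to the homogeneous
  coordinates of the intersection of the tangents \<open>u\<close> and \<open>v\<close>. The
  coefficients depend on \<open>w\<close> alone, so this is the equation of a conic, the confocal
  hyperbola, without fractions.\<close>

lemma chord_identity_mult:
  assumes "u \<in> carrier (jac m)" "v \<in> carrier (jac m)"
  defines "w \<equiv> u \<otimes>\<^bsub>jac m\<^esub> v"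
  shows "(1 + cn w) * (cn v - cn u)\<^sup>2 + (cn w - dn w) * (sn u - sn v)\<^sup>2
    = (1 - dn w) * (sn u * cn v - sn v * cn u)\<^sup>2"
proof -
  define D C N where
    "D = 1 - m * (sn u)\<^sup>2 * (sn v)\<^sup>2"
    and "C = cn u * cn v - sn u * sn v * dn u * dn v"
    and "N = dn u * dn v - m * sn u * sn v * cn u * cn v"
  have D: "D > 0"
    using assms sn_mult_denominator_pos by (simp add: D_def)
  have "(D + C) * (cn v - cn u)\<^sup>2 + (C - N) * (sn u - sn v)\<^sup>2
      = (D - N) * (sn u * cn v - sn v * cn u)\<^sup>2"
    using assms(1,2) unfolding mem_jac D_def C_def N_def by algebra
  moreover have "cn w = C / D" "dn w = N / D"
    by (simp_all add: w_def mult_jac D_def C_def N_def)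
  moreover have "1 + C / D = (D + C) / D" "C / D - N / D = (C - N) / D" "1 - N / D = (D - N) / D"
    using D by (simp_all add: field_simps)
  ultimately show ?thesis
    by (simp flip: add_divide_distrib)
qed

text \<open>Formally this is \<open>chord_identity_mult\<close> with \<open>dn v\<close> replaced by
  \<open>- dn v\<close>, which turns \<open>cn\<close> and \<open>dn\<close> of the product into
  \<open>cn\<close> and \<open>- dn\<close> of the quotient. It becomes the equation of the confocal
  ellipse.\<close>

lemma chord_identity_div:
  assumes "u \<in> carrier (jac m)" "v \<in> carrier (jac m)"
  defines "w \<equiv> u \<otimes>\<^bsub>jac m\<^esub> inv\<^bsub>jac m\<^esub> v"
  shows "(1 + cn w) * (cn v - cn u)\<^sup>2 + (cn w + dn w) * (sn u - sn v)\<^sup>2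
    = (1 + dn w) * (sn u * cn v - sn v * cn u)\<^sup>2"
proof -
  define D C N where
    "D = 1 - m * (sn u)\<^sup>2 * (sn v)\<^sup>2"
    and "C = cn u * cn v + sn u * sn v * dn u * dn v"
    and "N = dn u * dn v + m * sn u * sn v * cn u * cn v"
  have D: "D > 0"
    using assms sn_mult_denominator_pos by (simp add: D_def)
  have "(D + C) * (cn v - cn u)\<^sup>2 + (C + N) * (sn u - sn v)\<^sup>2
      = (D + N) * (sn u * cn v - sn v * cn u)\<^sup>2"
    using assms(1,2) unfolding mem_jac D_def C_def N_def by algebra
  moreover have "cn w = C / D" "dn w = N / D"
    using assms by (simp_all add: w_def mult_jac inv_jac D_def C_def N_def)
  moreover have "1 + C / D = (D + C) / D" "C / D + N / D = (C + N) / D" "1 + N / D = (D + N) / D"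
    using D by (simp_all add: field_simps)
  ultimately show ?thesis
    by (simp flip: add_divide_distrib)
qed

text \<open>The half-argument formula sn^2(w/2) = (1 - cn w) / (1 + dn w), written without
  division.\<close>

lemma sn_sq_double:
  assumes "u \<in> carrier (jac m)"
  defines "w \<equiv> u \<otimes>\<^bsub>jac m\<^esub> u"
  shows "1 - cn w = (1 + dn w) * (sn u)\<^sup>2"
proof -
  define D where "D = 1 - m * (sn u)\<^sup>2 * (sn u)\<^sup>2"
  have D: "D > 0"
    using assms sn_mult_denominator_pos by (simp add: D_def)
  have "D - (cn u * cn u - sn u * sn u * dn u * dn u)
      = (D + (dn u * dn u - m * sn u * sn u * cn u * cn u)) * (sn u)\<^sup>2"
    using assms(1) unfolding mem_jac D_def by algebra
  then show ?thesis
    using D unfolding w_def mult_jac D_def[symmetric] by (simp add: field_simps)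
qed

text \<open>If u + u is the identity, \<open>sn_sq_double\<close> gives sn u = 0, so u is the
  identity or the half period; the last hypothesis excludes the half period.\<close>

lemma jac_double_eq_one:
  assumes "u \<in> carrier (jac m)" "u \<otimes>\<^bsub>jac m\<^esub> u = \<one>\<^bsub>jac m\<^esub>" "cn u + dn u \<noteq> 0"
  shows "u = \<one>\<^bsub>jac m\<^esub>"
proof -
  have "1 - cn (u \<otimes>\<^bsub>jac m\<^esub> u) = 0" "1 + dn (u \<otimes>\<^bsub>jac m\<^esub> u) = 2"
    using assms(2) by (simp_all add: jac_def)
  then have s: "sn u = 0"
    using sn_sq_double[OF assms(1)] by simp
  then have "cn u = 1"
    using assms(1,3) cn_dn_half_period(1)[OF assms(1)] by (simp add: mem_jac power2_eq_1_iff)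
  then show ?thesis
    using s assms(1) by (intro jac_eqI) (auto simp: jac_def)
qed

lemma jac_eq_or_inv:
  assumes "u \<in> carrier (jac m)" "v \<in> carrier (jac m)" "cn u = cn v"
  shows "u = v \<or> u = inv\<^bsub>jac m\<^esub> v"
proof -
  have "(sn u)\<^sup>2 = (sn v)\<^sup>2"
    using assms unfolding mem_jac by algebra
  then have "sn u = sn v \<or> sn u = - sn v"
    by (simp add: power2_eq_iff)
  then show ?thesis
    using assms jac_eqI[of u v] jac_eqI[of u "inv\<^bsub>jac m\<^esub> v"] jac.inv_closed[of v] by (auto simp: inv_jac)
qed

end

subsection \<open>Tangents of the caustic and the confocal family\<close>

text \<open>By the half-argument formulas this is b^2 sn^2(w/2) / cn^2(w/2). It is infinite at the half period,
  where the two tangents are parallel.\<close>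
definition ellipse_of :: "real \<Rightarrow> hpt \<Rightarrow> real option" where
  "ellipse_of b w = (if cn w + dn w = 0 then None else Some (b\<^sup>2 * (1 - cn w) / (cn w + dn w)))"

text \<open>This is - a^2 dn^2(w/2), by the half-argument formulas.\<close>
definition hyperbola_of :: "real \<Rightarrow> real \<Rightarrow> hpt \<Rightarrow> real" where
  "hyperbola_of a b w = - (a\<^sup>2) + (a\<^sup>2 - b\<^sup>2) * (1 - cn w) / (1 + dn w)"

definition tline :: "real \<Rightarrow> real \<Rightarrow> hpt \<Rightarrow> pt set" where
  "tline a b u = {(x, y). sn u * x / a + cn u * y / b = 1}"

text \<open>Homogeneous line coordinates of \<open>tline a b u\<close>; \<open>cross\<close> of two
  such triples represents the intersection of the tangents, including points at infinity.\<close>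

definition tcoord :: "real \<Rightarrow> real \<Rightarrow> hpt \<Rightarrow> hpt" where
  "tcoord a b u = (sn u / a, cn u / b, - 1)"

definition scale :: "real \<Rightarrow> hpt \<Rightarrow> hpt" where
  "scale r = (\<lambda>(x, y, z). (r * x, r * y, r * z))"

lemma on_gconic_scale:
  assumes "r \<noteq> 0"
  shows "on_gconic a b E (scale r p) \<longleftrightarrow> on_gconic a b E p"
proof (cases E)
  case None
  then show ?thesis
    using assms by (cases p) (simp add: scale_def)
next
  case (Some k)
  obtain x y z where p: "p = (x, y, z)"
    by (metis prod_cases3)
  have "(b\<^sup>2 + k) * (r * x)\<^sup>2 + (a\<^sup>2 + k) * (r * y)\<^sup>2 = r\<^sup>2 * ((b\<^sup>2 + k) * x\<^sup>2 + (a\<^sup>2 + k) * y\<^sup>2)"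
    "(a\<^sup>2 + k) * (b\<^sup>2 + k) * (r * z)\<^sup>2 = r\<^sup>2 * ((a\<^sup>2 + k) * (b\<^sup>2 + k) * z\<^sup>2)"
    by algebra+
  then show ?thesis
    using assms by (simp only: Some p scale_def prod.case on_gconic.simps mult_cancel_left) simp
qed

lemma cross_scale: "cross (scale r p) (scale q p') = scale (r * q) (cross p p')"
  by (cases p; cases p') (simp add: scale_def cross_def algebra_simps)

lemma dehom_scale: "r \<noteq> 0 \<Longrightarrow> dehom (scale r p) = dehom p"
  by (cases p) (simp add: scale_def dehom_def)

text \<open>The equation \<open>b_sq\<close> says that \<open>m\<close> is the squared eccentricity
  of c, which ties the group \<open>jac m\<close> to the confocal family.\<close>

locale confocal = jacobi +
  fixes a b :: real
  assumes a_pos: "0 < a" and b_pos: "0 < b" and b_sq: "b\<^sup>2 = (1 - m) * a\<^sup>2"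
begin

text \<open>Normalising the equation by the half-axes of c exhibits the same three squares as in the
  chord identities, so only coefficients remain to be compared.\<close>

lemma on_gconic_cross:
  "on_gconic a b (Some k) (cross (tcoord a b u) (tcoord a b v)) \<longleftrightarrow>
    (b\<^sup>2 + k) / b\<^sup>2 * (cn v - cn u)\<^sup>2 + (a\<^sup>2 + k) / a\<^sup>2 * (sn u - sn v)\<^sup>2
    = (a\<^sup>2 + k) / a\<^sup>2 * ((b\<^sup>2 + k) / b\<^sup>2) * (sn u * cn v - sn v * cn u)\<^sup>2"
proof -
  have "cross (tcoord a b u) (tcoord a b v) =
    ((cn v - cn u) / b, (sn u - sn v) / a, (sn u * cn v - sn v * cn u) / (a * b))"
    using a_pos b_pos by (simp add: cross_def tcoord_def field_simps)
  then show ?thesis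
    by (simp add: power_divide power_mult_distrib)
qed

text \<open>In half arguments the two ratios are 1 / cn^2(w/2) and dn^2(w/2) / cn^2(w/2). The second
  uses b^2 = (1 - m) a^2 and dn^2 = 1 - m + m cn^2.\<close>

lemma ellipse_of_eq_Some:
  assumes w: "w \<in> carrier (jac m)" and k: "ellipse_of b w = Some k"
  shows "(b\<^sup>2 + k) / b\<^sup>2 = (1 + dn w) / (cn w + dn w)" "(a\<^sup>2 + k) / a\<^sup>2 = (1 + dn w) / (1 + cn w)"
    "0 < cn w + dn w" "0 < 1 + cn w" "0 \<le> k"
proof -
  have nz: "cn w + dn w \<noteq> 0" and k': "k = b\<^sup>2 * (1 - cn w) / (cn w + dn w)"
    using k by (auto simp: ellipse_of_def split: if_splits)
  note bounds = cn_dn_bounds[OF w]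
  show pos: "0 < cn w + dn w" "0 < 1 + cn w"
    using nz bounds cn_dn_half_period[OF w] by auto
  show "0 \<le> k"
    using pos bounds k' by simp
  show "(b\<^sup>2 + k) / b\<^sup>2 = (1 + dn w) / (cn w + dn w)"
  proof -
    have "(b\<^sup>2 + k) / b\<^sup>2 = 1 + (1 - cn w) / (cn w + dn w)"
      using b_pos by (simp add: k' add_divide_distrib)
    then show ?thesis
      using pos by (simp add: field_simps)
  qed
  have "(a\<^sup>2 + k) / a\<^sup>2 = 1 + (1 - m) * (1 - cn w) / (cn w + dn w)"
    using a_pos by (simp add: k' b_sq add_divide_distrib)
  also have "\<dots> = (cn w + dn w + (1 - m) * (1 - cn w)) / (cn w + dn w)"
    using pos by (simp add: field_simps)
  also have "\<dots> = (1 + dn w) / (1 + cn w)"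
  proof -
    have "(cn w + dn w + (1 - m) * (1 - cn w)) * (1 + cn w) = (1 + dn w) * (cn w + dn w)"
      using dn_sq[OF w] by algebra
    then show ?thesis
      using pos by (simp add: frac_eq_eq)
  qed
  finally show "(a\<^sup>2 + k) / a\<^sup>2 = (1 + dn w) / (1 + cn w)" .
qed

text \<open>With the ratios of \<open>ellipse_of_eq_Some\<close>, the equation of the ellipse is
  \<open>chord_identity_div\<close> times a common factor.\<close>

lemma tangents_meet_on_ellipse:
  assumes u: "u \<in> carrier (jac m)" and v: "v \<in> carrier (jac m)"
  shows "on_gconic a b (ellipse_of b (u \<otimes>\<^bsub>jac m\<^esub> inv\<^bsub>jac m\<^esub> v)) (cross (tcoord a b u) (tcoord a b v))"
proof -
  let ?w = "u \<otimes>\<^bsub>jac m\<^esub> inv\<^bsub>jac m\<^esub> v"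
  have w: "?w \<in> carrier (jac m)"
    using u v by simp
  note id = chord_identity_div[OF u v]
  show ?thesis
  proof (cases "ellipse_of b ?w")
    case None
    then have "cn ?w + dn ?w = 0"
      by (simp add: ellipse_of_def split: if_splits)
    \<comment> \<open>Here both coefficients on the left of the chord identity vanish while the
      right one is 2, so the third coordinate is 0.\<close>
    then have "cn ?w = - 1" "dn ?w = 1"
      using cn_dn_half_period[OF w] by auto
    then have "sn u * cn v - sn v * cn u = 0"
      using id by simp
    then show ?thesis
      using a_pos b_pos by (simp add: None cross_def tcoord_def field_simps)
  next
    case (Some k)
    let ?C = "cn ?w" and ?D = "dn ?w"
    let ?x = "(cn v - cn u)\<^sup>2" and ?y = "(sn u - sn v)\<^sup>2" and ?z = "(sn u * cn v - sn v * cn u)\<^sup>2"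
    note e = ellipse_of_eq_Some[OF w Some]
    have "(1 + ?D) / (?C + ?D) * ?x + (1 + ?D) / (1 + ?C) * ?y
      = (1 + ?D) / ((?C + ?D) * (1 + ?C)) * ((1 + ?C) * ?x + (?C + ?D) * ?y)"
      using e(3,4) by (simp add: field_simps)
    also have "\<dots> = (1 + ?D) / (1 + ?C) * ((1 + ?D) / (?C + ?D)) * ?z"
      unfolding id by (simp add: ac_simps)
    finally show ?thesis
      unfolding Some on_gconic_cross e(1,2) .
  qed
qed

lemma tangents_meet_on_hyperbola:
  assumes u: "u \<in> carrier (jac m)" and v: "v \<in> carrier (jac m)"
  shows "on_gconic a b (Some (hyperbola_of a b (u \<otimes>\<^bsub>jac m\<^esub> v))) (cross (tcoord a b u) (tcoord a b v))"
proof -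
  let ?w = "u \<otimes>\<^bsub>jac m\<^esub> v"
  let ?C = "cn ?w" and ?D = "dn ?w"
  let ?x = "(cn v - cn u)\<^sup>2" and ?y = "(sn u - sn v)\<^sup>2" and ?z = "(sn u * cn v - sn v * cn u)\<^sup>2"
  have w: "?w \<in> carrier (jac m)"
    using u v by simp
  note id = chord_identity_mult[OF u v]
  have D: "1 + ?D > 0"
    using cn_dn_bounds[OF w] by linarith
  have k: "(a\<^sup>2 + hyperbola_of a b ?w) / a\<^sup>2 = m * (1 - ?C) / (1 + ?D)"
    "(b\<^sup>2 + hyperbola_of a b ?w) / b\<^sup>2 = - m * (?C + ?D) / ((1 - m) * (1 + ?D))"
  proof -
    \<comment> \<open>\<open>t\<close> is sn^2(w/2); in terms of it the two ratios are m t and m (t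
      - 1) / (1 - m).\<close>
    define t where "t = (1 - ?C) / (1 + ?D)"
    have h: "hyperbola_of a b ?w = - (a\<^sup>2) + a\<^sup>2 * m * t"
      by (simp add: hyperbola_of_def t_def b_sq algebra_simps)
    show "(a\<^sup>2 + hyperbola_of a b ?w) / a\<^sup>2 = m * (1 - ?C) / (1 + ?D)"
      using a_pos by (simp add: h) (simp add: t_def)
    have "(b\<^sup>2 + hyperbola_of a b ?w) / b\<^sup>2 = a\<^sup>2 * (m * (t - 1)) / (a\<^sup>2 * (1 - m))"
      by (simp add: h b_sq algebra_simps)
    also have "\<dots> = m * (t - 1) / (1 - m)"
      using a_pos by simp
    also have "t - 1 = - (?C + ?D) / (1 + ?D)"
      using D by (simp add: t_def field_simps)
    finally show "(b\<^sup>2 + hyperbola_of a b ?w) / b\<^sup>2 = - m * (?C + ?D) / ((1 - m) * (1 + ?D))"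
      by (simp add: algebra_simps)
  qed
  show ?thesis
  proof (cases "?C = - 1")
    \<comment> \<open>At the half period the hyperbola degenerates to the x-axis, and the chord
      identity reduces to the vanishing of the second coordinate.\<close>
    case True
    then have "?D = 1"
      using cn_dn_half_period[OF w] by simp
    then show ?thesis
      unfolding on_gconic_cross k using id True by simp
  next
    case False
    then have C: "1 + ?C \<noteq> 0"
      by simp
    \<comment> \<open>Both facts are dn^2 = 1 - m + m cn^2 in disguise. They allow a common factor
      to be extracted that leaves the left side of the chord identity.\<close>
    have 1: "m * (1 - ?C) / (1 + ?D) = (1 - ?D) / (1 + ?C)"
      using C D dn_sq[OF w] by (simp add: frac_eq_eq) algebra
    have 2: "(1 - ?D) * (1 - m) * (1 + ?D) = - m * (?C + ?D) * (?C - ?D)"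
      using dn_sq[OF w] by algebra
    have "- m * (?C + ?D) / ((1 - m) * (1 + ?D)) * ?x + (1 - ?D) / (1 + ?C) * ?y
      = - m * (?C + ?D) / ((1 - m) * (1 + ?D) * (1 + ?C)) * ((1 + ?C) * ?x + (?C - ?D) * ?y)"
    proof -
      have "(1 - ?D) / (1 + ?C) = - m * (?C + ?D) / ((1 - m) * (1 + ?D) * (1 + ?C)) * (?C - ?D)"
      proof -
        have "(1 - ?D) / (1 + ?C) = (1 - ?D) * (1 - m) * (1 + ?D) / ((1 - m) * (1 + ?D) * (1 + ?C))"
          using C D m_less by simp
        then show ?thesis
          unfolding 2 by simp
      qed
      moreover have "- m * (?C + ?D) / ((1 - m) * (1 + ?D))
        = - m * (?C + ?D) / ((1 - m) * (1 + ?D) * (1 + ?C)) * (1 + ?C)"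
        using C by simp
      moreover have "r * p * x + r * q * y = r * (p * x + q * y)" for r p q x y :: real
        by (simp add: algebra_simps)
      ultimately show ?thesis
        by metis
    qed
    also have "\<dots> = (1 - ?D) / (1 + ?C) * (- m * (?C + ?D) / ((1 - m) * (1 + ?D))) * ?z"
      unfolding id by (simp add: ac_simps)
    finally show ?thesis
      unfolding on_gconic_cross k 1 .
  qed
qed

text \<open>The quotient sn^2(w/2) lies between 0 and 1; its extreme values give the two coordinate
  axes.\<close>

lemma hyperbola_of_bounds:
  assumes "w \<in> carrier (jac m)"
  shows "- (a\<^sup>2) \<le> hyperbola_of a b w" "hyperbola_of a b w \<le> - (b\<^sup>2)"
proof -
  note bounds = cn_dn_bounds[OF assms]
  have "0 \<le> (1 - cn w) / (1 + dn w)" "(1 - cn w) / (1 + dn w) \<le> 1"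
    using bounds by (auto simp: divide_le_eq)
  moreover have "0 \<le> a\<^sup>2 - b\<^sup>2"
    unfolding b_sq using m_pos by (simp add: algebra_simps)
  ultimately have "0 \<le> (a\<^sup>2 - b\<^sup>2) * ((1 - cn w) / (1 + dn w))"
    "(a\<^sup>2 - b\<^sup>2) * ((1 - cn w) / (1 + dn w)) \<le> (a\<^sup>2 - b\<^sup>2) * 1"
    by (intro mult_nonneg_nonneg mult_left_mono; simp)+
  then show "- (a\<^sup>2) \<le> hyperbola_of a b w" "hyperbola_of a b w \<le> - (b\<^sup>2)"
    by (simp_all add: hyperbola_of_def)
qed

text \<open>The limiting case u = v of \<open>tangents_meet_on_hyperbola\<close>: by
  \<open>sn_sq_double\<close> the parameter is -a^2 + (a^2 - b^2) sn^2 u.\<close>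

lemma contact_on_hyperbola:
  assumes u: "u \<in> carrier (jac m)"
  shows "on_gconic a b (Some (hyperbola_of a b (u \<otimes>\<^bsub>jac m\<^esub> u))) (a * sn u, b * cn u, 1)"
proof -
  have "1 + dn (u \<otimes>\<^bsub>jac m\<^esub> u) > 0"
    using cn_dn_bounds[of "u \<otimes>\<^bsub>jac m\<^esub> u"] u by simp
  then have "hyperbola_of a b (u \<otimes>\<^bsub>jac m\<^esub> u) = - (a\<^sup>2) + (a\<^sup>2 - b\<^sup>2) * (sn u)\<^sup>2"
    using sn_sq_double[OF u] by (simp add: hyperbola_of_def)
  moreover have "(cn u)\<^sup>2 = 1 - (sn u)\<^sup>2"
    using u by (simp add: mem_jac algebra_simps)
  ultimately show ?thesis
    by (simp add: power_mult_distrib) (simp add: algebra_simps)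
qed

text \<open>Interchanging the two tangents inverts their difference but not their intersection;
  accordingly only \<open>cn\<close> and \<open>dn\<close> enter.\<close>

lemma ellipse_of_inv: "w \<in> carrier (jac m) \<Longrightarrow> ellipse_of b (inv\<^bsub>jac m\<^esub> w) = ellipse_of b w"
  by (simp add: ellipse_of_def inv_jac)

lemma ellipse_of_inj:
  assumes w: "w \<in> carrier (jac m)" "w' \<in> carrier (jac m)"
    and e: "ellipse_of b w = Some k" "ellipse_of b w' = Some k"
  shows "cn w = cn w'"
proof -
  have k_eq: "k * (cn v + dn v) = b\<^sup>2 * (1 - cn v)" if "ellipse_of b v = Some k" for v
    using that by (auto simp: ellipse_of_def split: if_splits)
  \<comment> \<open>The sum cn + dn increases with cn because m |cn v + cn v'| < dn v + dn v'. Hence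
    the denominator of \<open>ellipse_of\<close> grows while its numerator strictly
    decreases.\<close>
  have less: False if "v \<in> carrier (jac m)" "v' \<in> carrier (jac m)"
    "ellipse_of b v = Some k" "ellipse_of b v' = Some k" "cn v < cn v'" for v v'
  proof -
    note e = ellipse_of_eq_Some[OF that(1,3)] ellipse_of_eq_Some[OF that(2,4)]
    note bounds = cn_dn_bounds[OF that(1)] cn_dn_bounds[OF that(2)]
    have "dn v + dn v' > 0" "m * (cn v + cn v') > - (dn v + dn v')"
    proof -
      show "dn v + dn v' > 0"
        using bounds by linarith
      have "m * \<bar>cn v + cn v'\<bar> < 1 * (dn v + dn v')"
        using bounds m_pos m_less \<open>dn v + dn v' > 0\<close>
          mult_left_mono[of "\<bar>cn v + cn v'\<bar>" "dn v + dn v'" m]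
          mult_strict_right_mono[OF m_less, of "dn v + dn v'"]
        by linarith
      moreover have "m * (- \<bar>cn v + cn v'\<bar>) \<le> m * (cn v + cn v')"
        using m_pos by (intro mult_left_mono) auto
      ultimately show "m * (cn v + cn v') > - (dn v + dn v')"
        by simp
    qed
    moreover have "(dn v' - dn v + (cn v' - cn v)) * (dn v + dn v')
      = (cn v' - cn v) * (m * (cn v + cn v') + (dn v + dn v'))"
      using dn_sq[OF that(1)] dn_sq[OF that(2)] by algebra
    ultimately have "0 < (dn v' - dn v + (cn v' - cn v)) * (dn v + dn v')"
      using that(5) by simp
    then have "cn v + dn v < cn v' + dn v'"
      using \<open>dn v + dn v' > 0\<close> by (simp add: zero_less_mult_iff)
    then have "k * (cn v + dn v) \<le> k * (cn v' + dn v')"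
      using e by (simp add: mult_left_mono)
    moreover have "k * (cn v + dn v) = b\<^sup>2 * (1 - cn v)" "k * (cn v' + dn v') = b\<^sup>2 * (1 - cn v')"
      using k_eq that(3,4) by blast+
    ultimately show False
      using that(5) b_pos by simp
  qed
  show ?thesis
    using less[OF w e] less[OF w(2) w(1) e(2) e(1)] by (meson linorder_less_linear)
qed

section \<open>Incidence of points and tangent lines\<close>

lemma cross_tcoord:
  assumes u: "u \<in> carrier (jac m)" and v: "v \<in> carrier (jac m)" and "u \<noteq> v"
    and p: "p \<in> tline a b u" "p \<in> tline a b v"
  shows "\<exists>r. r \<noteq> 0 \<and> cross (tcoord a b u) (tcoord a b v) = scale r (hom p)"
proof -
  obtain x y where xy: "p = (x, y)"
    by (cases p)
  let ?Z = "sn u * cn v - sn v * cn u"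
  have "sn u * (x / a) + cn u * (y / b) = 1" "sn v * (x / a) + cn v * (y / b) = 1"
    using p by (simp_all add: xy tline_def)
  then have X: "?Z * (x / a) = cn v - cn u" and Y: "?Z * (y / b) = sn u - sn v"
    by algebra+
  \<comment> \<open>If this determinant vanished, Cramer's rule would give equal \<open>sn\<close>
    and \<open>cn\<close>, hence u = v.\<close>
  have "?Z \<noteq> 0"
    using X Y jac_eqI[OF u v] \<open>u \<noteq> v\<close> by auto
  moreover have "cross (tcoord a b u) (tcoord a b v) =
    ((cn v - cn u) / b, (sn u - sn v) / a, ?Z / (a * b))"
    using a_pos b_pos by (simp add: cross_def tcoord_def field_simps)
  then have "cross (tcoord a b u) (tcoord a b v) = scale (?Z / (a * b)) (hom p)"
    by (simp add: X[symmetric] Y[symmetric] xy hom_def scale_def mult.commute)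
  ultimately show ?thesis
    using a_pos b_pos by (intro exI[of _ "?Z / (a * b)"]) simp
qed

lemma tline_inter_unique:
  assumes "u \<in> carrier (jac m)" "v \<in> carrier (jac m)" "u \<noteq> v"
    and "p \<in> tline a b u" "p \<in> tline a b v" "q \<in> tline a b u" "q \<in> tline a b v"
  shows "p = q"
proof -
  obtain r s where "scale r (hom p) = scale s (hom q)" "r \<noteq> 0"
    using cross_tcoord[OF assms(1-5)] cross_tcoord[OF assms(1-3,6,7)] by metis
  then show ?thesis
    by (auto simp: scale_def hom_def prod_eq_iff)
qed

lemma dehom_cross_tcoord:
  assumes "snd (snd (cross (tcoord a b u) (tcoord a b v))) \<noteq> 0"
  shows "dehom (cross (tcoord a b u) (tcoord a b v)) \<in> tline a b u"
    "dehom (cross (tcoord a b u) (tcoord a b v)) \<in> tline a b v"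
proof -
  let ?Z = "sn u * cn v - sn v * cn u"
  have c: "cross (tcoord a b u) (tcoord a b v) =
    ((cn v - cn u) / b, (sn u - sn v) / a, ?Z / (a * b))"
    using a_pos b_pos by (simp add: cross_def tcoord_def field_simps)
  then have "?Z \<noteq> 0"
    using assms by auto
  moreover from this have
    "dehom (cross (tcoord a b u) (tcoord a b v)) = (a * ((cn v - cn u) / ?Z), b * ((sn u - sn v) / ?Z))"
    using a_pos b_pos unfolding c by (simp add: dehom_def)
  moreover have "sn u * (cn v - cn u) + cn u * (sn u - sn v) = ?Z"
    "sn v * (cn v - cn u) + cn v * (sn u - sn v) = ?Z"
    by algebra+
  ultimately show "dehom (cross (tcoord a b u) (tcoord a b v)) \<in> tline a b u"
    "dehom (cross (tcoord a b u) (tcoord a b v)) \<in> tline a b v"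
    using a_pos b_pos by (simp_all add: tline_def flip: add_divide_distrib)
qed

text \<open>Scale c to the unit circle and let \<open>t z\<close> be the signed distance along the
  tangent from its contact point to p. Its square is |p|^2 - 1, so it takes at most two values, and
  p together with \<open>t z\<close> determines z.\<close>

lemma at_most_two_tangents:
  assumes "u \<in> carrier (jac m)" "v \<in> carrier (jac m)" "w \<in> carrier (jac m)"
    and "p \<in> tline a b u" "p \<in> tline a b v" "p \<in> tline a b w"
  shows "u = v \<or> v = w \<or> u = w"
proof -
  define x y where "x = fst p / a" and "y = snd p / b"
  define t where "t z = sn z * y - cn z * x" for z :: hpt
  have coords: "(x\<^sup>2 + y\<^sup>2) * sn z = x + t z * y \<and> (x\<^sup>2 + y\<^sup>2) * cn z = y - t z * x
      \<and> (t z)\<^sup>2 = x\<^sup>2 + y\<^sup>2 - 1"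
    if "z \<in> carrier (jac m)" "p \<in> tline a b z" for z
  proof -
    have "sn z * x + cn z * y = 1"
      using that by (cases p) (simp add: tline_def x_def y_def)
    then show ?thesis
      using that(1) unfolding mem_jac t_def by algebra
  qed
  have "0 < x\<^sup>2 + y\<^sup>2"
    using coords[OF assms(1,4)] zero_le_power2[of "t u"] by linarith
  then have eq: "z = z'" if "t z = t z'" "z \<in> carrier (jac m)" "p \<in> tline a b z"
      "z' \<in> carrier (jac m)" "p \<in> tline a b z'" for z z'
    using coords[OF that(2,3)] coords[OF that(4,5)] that(1)
    by (intro jac_eqI that) (metis mult_cancel_left less_irrefl)+
  have "(t u)\<^sup>2 = (t v)\<^sup>2" "(t v)\<^sup>2 = (t w)\<^sup>2"
    using coords assms by simp_all
  then have "t u = t v \<or> t v = t w \<or> t u = t w"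
    by (auto simp: power2_eq_iff)
  then show ?thesis
    using eq assms by blast
qed

lemma aline_eq_tline:
  assumes u: "u \<in> carrier (jac m)" and "p \<noteq> q" "p \<in> tline a b u" "q \<in> tline a b u"
  shows "aline p q = tline a b u"
proof -
  define f g where "f = sn u / a" and "g = cn u / b"
  have L: "tline a b u = {(x, y). f * x + g * y = 1}"
    by (simp add: tline_def f_def g_def)
  obtain x y x' y' where pq: "p = (x, y)" "q = (x', y')"
    by (cases p; cases q)
  have 1: "f * x + g * y = 1" "f * x' + g * y' = 1"
    using assms by (simp_all add: L pq)
  show ?thesis
  proof (intro equalityI subsetI)
    fix r assume "r \<in> aline p q"
    then obtain t where "r = (x + t * (x' - x), y + t * (y' - y))"
      by (auto simp: aline_def pq)
    moreover have "f * (x + t * (x' - x)) + g * (y + t * (y' - y)) = 1"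
      using 1 by algebra
    ultimately show "r \<in> tline a b u"
      by (simp add: L)
  next
    fix r assume "r \<in> tline a b u"
    then obtain z w where r: "r = (z, w)" "f * z + g * w = 1"
      by (auto simp: L)
    \<comment> \<open>The parameter \<open>t\<close> comes from the orthogonal projection onto the
      direction of the line, which avoids a case distinction for vertical lines.\<close>
    define n where "n = (x' - x)\<^sup>2 + (y' - y)\<^sup>2"
    define t where "t = ((z - x) * (x' - x) + (w - y) * (y' - y)) / n"
    have n: "n \<noteq> 0"
      using \<open>p \<noteq> q\<close> by (auto simp: n_def pq sum_power2_eq_zero_iff)
    have D: "(z - x) * (y' - y) = (w - y) * (x' - x)"
      using 1 r(2) by algebra
    have "t * n = (z - x) * (x' - x) + (w - y) * (y' - y)"
      using n by (simp add: t_def)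
    then have "n * (x + t * (x' - x)) = n * z" "n * (y + t * (y' - y)) = n * w"
      using D unfolding n_def by algebra+
    then have "r = (x + t * (x' - x), y + t * (y' - y))"
      using n r by simp
    then show "r \<in> aline p q"
      by (auto simp: aline_def pq)
  qed
qed

text \<open>In scaled coordinates the point and the contact point are unit vectors with inner
  product 1, so their squared distance is 1 - 2 + 1 = 0.\<close>

lemma conf_0_inter_tline:
  assumes u: "u \<in> carrier (jac m)"
  shows "X \<in> conf a b 0 \<and> X \<in> tline a b u \<longleftrightarrow> X = (a * sn u, b * cn u)"
proof -
  have h: "(sn u)\<^sup>2 + (cn u)\<^sup>2 = 1"
    using u by (simp add: mem_jac)
  obtain x y where X: "X = (x, y)"
    by (cases X)
  have "X \<in> conf a b 0 \<and> X \<in> tline a b u \<longleftrightarrow>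
      (x / a)\<^sup>2 + (y / b)\<^sup>2 = 1 \<and> sn u * (x / a) + cn u * (y / b) = 1"
    by (simp add: X conf_def tline_def power_divide)
  also have "\<dots> \<longleftrightarrow> x / a = sn u \<and> y / b = cn u"
  proof
    assume "(x / a)\<^sup>2 + (y / b)\<^sup>2 = 1 \<and> sn u * (x / a) + cn u * (y / b) = 1"
    then have "(x / a - sn u)\<^sup>2 + (y / b - cn u)\<^sup>2 = 0"
      using h by algebra
    then show "x / a = sn u \<and> y / b = cn u"
      by (simp add: sum_power2_eq_zero_iff)
  next
    assume "x / a = sn u \<and> y / b = cn u"
    then show "(x / a)\<^sup>2 + (y / b)\<^sup>2 = 1 \<and> sn u * (x / a) + cn u * (y / b) = 1"
      using h by (simp add: power2_eq_square)
  qed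
  also have "\<dots> \<longleftrightarrow> X = (a * sn u, b * cn u)"
    using a_pos b_pos by (auto simp: X field_simps)
  finally show ?thesis .
qed

lemma tangent_toI:
  assumes "u \<in> carrier (jac m)" "p \<noteq> q" "p \<in> tline a b u" "q \<in> tline a b u"
  shows "tangent_to (conf a b 0) p q"
  unfolding tangent_to_def aline_eq_tline[OF assms] conf_0_inter_tline[OF assms(1)] by simp

lemma tangent_toE:
  assumes "tangent_to (conf a b 0) p q" "p \<noteq> q"
  obtains u where "u \<in> carrier (jac m)" "p \<in> tline a b u" "q \<in> tline a b u"
proof -
  obtain x y x' y' where pq: "p = (x, y)" "q = (x', y')"
    by (cases p; cases q)
  define e f where "e = (x' - x) / a" and "f = (y' - y) / b"
  have in_conf: "(x + t * (x' - x), y + t * (y' - y)) \<in> conf a b 0 \<longleftrightarrow>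
      (x / a + t * e)\<^sup>2 + (y / b + t * f)\<^sup>2 = 1" for t
  proof -
    have "x / a + t * e = (x + t * (x' - x)) / a" "y / b + t * f = (y + t * (y' - y)) / b"
      by (simp_all add: e_def f_def add_divide_distrib)
    then show ?thesis
      by (simp only:) (simp add: conf_def power_divide)
  qed
  have in_aline: "(x + t * (x' - x), y + t * (y' - y)) \<in> aline p q" for t
    by (auto simp: aline_def pq)
  obtain X where "X \<in> conf a b 0" "X \<in> aline p q"
    and uniq: "\<And>Y. Y \<in> conf a b 0 \<Longrightarrow> Y \<in> aline p q \<Longrightarrow> Y = X"
    using assms(1) unfolding tangent_to_def by blast
  obtain t where X: "X = (x + t * (x' - x), y + t * (y' - y))"
    using \<open>X \<in> aline p q\<close> by (auto simp: aline_def pq)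
  define s c where "s = x / a + t * e" and "c = y / b + t * f"
  have sc: "s\<^sup>2 + c\<^sup>2 = 1"
    using \<open>X \<in> conf a b 0\<close> unfolding X in_conf s_def c_def .
  define n g where "n = e\<^sup>2 + f\<^sup>2" and "g = s * e + c * f"
  have n: "n \<noteq> 0"
    using assms(2) a_pos b_pos by (auto simp: n_def e_def f_def sum_power2_eq_zero_iff pq)
  \<comment> \<open>The parameter of the second intersection of the line with the scaled circle.
    Uniqueness of the common point forces t' = t, so g = 0 and the line is perpendicular to the
    radius at X.\<close>
  define t' where "t' = t - 2 * g / n"
  have t': "(t' - t) * n = - 2 * g"
    using n by (simp add: t'_def)
  have "(x / a + t' * e)\<^sup>2 + (y / b + t' * f)\<^sup>2 = s\<^sup>2 + c\<^sup>2 + (t' - t) * (2 * g + (t' - t) * n)"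
    unfolding s_def c_def g_def n_def by algebra
  then have "(x / a + t' * e)\<^sup>2 + (y / b + t' * f)\<^sup>2 = 1"
    using sc t' by simp
  then have "(x + t' * (x' - x), y + t' * (y' - y)) = X"
    using uniq in_conf in_aline by blast
  then have "t' = t"
    using assms(2) by (auto simp: X pq)
  then have g: "g = 0"
    using t' by simp
  define u where "u = (s, c, sqrt (1 - m * s\<^sup>2))"
  have "m * s\<^sup>2 < 1"
    using sc denominator_pos[of s c 1 0] by simp
  then have "u \<in> carrier (jac m)"
    using sc by (simp add: u_def mem_jac_triple)
  moreover have "s * (x / a) + c * (y / b) = 1" "s * (x / a + e) + c * (y / b + f) = 1"
    using g sc unfolding s_def c_def g_def by algebra+
  then have "p \<in> tline a b u" "q \<in> tline a b u"
    by (simp_all add: tline_def u_def pq e_def f_def diff_divide_distrib)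
  ultimately show ?thesis
    using that by blast
qed

lemma hline_eq_scale_tcoord:
  assumes "p \<noteq> q" "p \<in> tline a b u" "q \<in> tline a b u"
  shows "\<exists>r. r \<noteq> 0 \<and> hline p q = scale r (tcoord a b u)"
proof -
  define f g where "f = sn u / a" and "g = cn u / b"
  obtain x y x' y' where pq: "p = (x, y)" "q = (x', y')"
    by (cases p; cases q)
  have 1: "f * x + g * y = 1" "f * x' + g * y' = 1"
    using assms by (simp_all add: pq tline_def f_def g_def)
  \<comment> \<open>The factor is read off from the last coordinates, which are \<open>- ?r\<close>
    for \<open>hline p q\<close> and -1 for \<open>tcoord\<close>.\<close>
  let ?r = "y * x' - x * y'"
  have 2: "y - y' = ?r * f" "x' - x = ?r * g"
    using 1 by algebra+
  then have "?r \<noteq> 0"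
    using assms(1) by (auto simp: pq)
  moreover have "hline p q = scale ?r (tcoord a b u)"
    using 2 by (simp add: hline_def cross_def hom_def pq scale_def tcoord_def flip: f_def g_def)
  ultimately show ?thesis
    by blast
qed

lemma on_gconic_hom_iff_conf:
  assumes "0 \<le> k"
  shows "on_gconic a b (Some k) (hom p) \<longleftrightarrow> p \<in> conf a b k"
proof -
  have "a\<^sup>2 + k > 0" "b\<^sup>2 + k > 0"
    using assms a_pos b_pos by (simp_all add: add_pos_nonneg)
  then show ?thesis
    by (cases p) (simp add: conf_def hom_def add_frac_eq divide_eq_eq mult.commute)
qed

text \<open>At a point other than the origin the left side of the equation strictly decreases as the
  parameter grows.\<close>

lemma conf_parameter_unique:
  assumes "0 \<le> k" "0 \<le> l" "p \<in> conf a b k" "p \<in> conf a b l"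
  shows "k = l"
proof -
  have *: False if "0 \<le> k" "k < l" "p \<in> conf a b k" "p \<in> conf a b l" for k l
  proof -
    obtain x y where p: "p = (x, y)"
      by (cases p)
    have pos: "a\<^sup>2 + k > 0" "b\<^sup>2 + k > 0"
      using that a_pos b_pos by (simp_all add: add_pos_nonneg)
    have 1: "x\<^sup>2 / (a\<^sup>2 + k) + y\<^sup>2 / (b\<^sup>2 + k) = 1" "x\<^sup>2 / (a\<^sup>2 + l) + y\<^sup>2 / (b\<^sup>2 + l) = 1"
      using that by (simp_all add: p conf_def)
    have le: "z\<^sup>2 / (c + l) \<le> z\<^sup>2 / (c + k)" if "c + k > 0" for z c :: real
      using that \<open>k < l\<close> by (intro divide_left_mono) auto
    have less: "z\<^sup>2 / (c + l) < z\<^sup>2 / (c + k)" if "c + k > 0" "z \<noteq> 0" for z c :: real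
      using that \<open>k < l\<close> by (intro divide_strict_left_mono) auto
    have "x \<noteq> 0 \<or> y \<noteq> 0"
      using 1 by auto
    then show False
      using 1 le[of "a\<^sup>2" x] le[of "b\<^sup>2" y] less[of "a\<^sup>2" x] less[of "b\<^sup>2" y] pos by linarith
  qed
  show ?thesis
    using *[of k l] *[of l k] assms by (meson linorder_less_linear)
qed

subsection \<open>Billiards\<close>

text \<open>Each vertex lies on e and on two consecutive tangents, so e fixes their difference up to
  sign; the remaining work is to show that the sign never changes.\<close>

lemma billiard_contacts:
  assumes bill: "billiard a b k P"
  obtains u d where "\<And>i. u i \<in> carrier (jac m)" "d \<in> carrier (jac m)"
    "\<And>i. u (i + 1) = u i \<otimes>\<^bsub>jac m\<^esub> d" "\<And>i. u (i + 1) \<noteq> u i"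
    "\<And>i. P i \<in> tline a b (u i)" "\<And>i. P (i + 1) \<in> tline a b (u i)"
    "ellipse_of b d = Some k"
proof -
  have k: "0 < k" and on_e: "P i \<in> conf a b k" and P_ne: "P (i + 1) \<noteq> P i"
    and tan: "tangent_to (conf a b 0) (P i) (P (i + 1))"
    and sides: "aline (P (i - 1)) (P i) \<noteq> aline (P i) (P (i + 1))" for i
    using bill by (auto simp: billiard_def)
  have "\<forall>i. \<exists>u. u \<in> carrier (jac m) \<and> P i \<in> tline a b u \<and> P (i + 1) \<in> tline a b u"
    using tangent_toE[OF tan P_ne[symmetric]] by blast
  then obtain u where u: "u i \<in> carrier (jac m)" "P i \<in> tline a b (u i)"
    "P (i + 1) \<in> tline a b (u i)" for i
    by metis
  have u_ne: "u (i + 1) \<noteq> u i" for i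
  proof
    assume eq: "u (i + 1) = u i"
    have "aline (P i) (P (i + 1)) = tline a b (u i)"
      using aline_eq_tline[of "u i"] u[of i] P_ne[of i] by metis
    moreover have "aline (P (i + 1)) (P (i + 1 + 1)) = tline a b (u i)"
      using aline_eq_tline[of "u i"] u[of "i + 1"] P_ne[of "i + 1"] eq by metis
    ultimately show False
      using sides[of "i + 1"] by simp
  qed
  define d where "d i = u (i + 1) \<otimes>\<^bsub>jac m\<^esub> inv\<^bsub>jac m\<^esub> u i" for i
  have d: "d i \<in> carrier (jac m)" for i
    using u by (simp add: d_def)
  have u_d: "u (i + 1) = u i \<otimes>\<^bsub>jac m\<^esub> d i" for i
    using u by (simp add: d_def jac.mult_div_cancel)
  have e_d: "ellipse_of b (d i) = Some k" for i
  proof -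
    obtain r where "r \<noteq> 0"
      "cross (tcoord a b (u (i + 1))) (tcoord a b (u i)) = scale r (hom (P (i + 1)))"
      using cross_tcoord[OF u(1) u(1) u_ne] u by metis
    then have *: "on_gconic a b (ellipse_of b (d i)) (hom (P (i + 1)))"
      using tangents_meet_on_ellipse[of "u (i + 1)" "u i"] u by (simp add: d_def on_gconic_scale)
    show ?thesis
    \<comment> \<open>A vertex is an affine point, so the line at infinity is impossible, and only
      one confocal ellipse passes through it.\<close>
    proof (cases "ellipse_of b (d i)")
      case None
      then show ?thesis
        using * by (simp add: hom_def)
    next
      case (Some l)
      then have "0 \<le> l"
        using ellipse_of_eq_Some(5)[OF d] by simp
      then show ?thesis
        using * Some on_gconic_hom_iff_conf conf_parameter_unique[of l k] on_e k
        by (metis less_imp_le)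
    qed
  qed
  \<comment> \<open>With opposite steps the tangents with indices i and i + 2 agree. Then P (i + 1)
    and P (i + 2) are both the intersection of the tangents i and i + 1.\<close>
  have d_step: "d (i + 1) = d i" for i
  proof (rule ccontr)
    assume "d (i + 1) \<noteq> d i"
    then have "d (i + 1) = inv\<^bsub>jac m\<^esub> d i"
      using jac_eq_or_inv[OF d d] ellipse_of_inj[OF d d e_d e_d] by blast
    then have eq: "u (i + 1 + 1) = u i"
      using u_d[of "i + 1"] u_d[of i] u d by (simp add: jac.m_assoc)
    have "P (i + 1 + 1) = P (i + 1)"
      by (rule tline_inter_unique[OF u(1) u(1) u_ne])
        (use u[of "i + 1"] u[of i] u[of "i + 1 + 1"] eq in auto)
    then show False
      using P_ne by blast
  qed
  have "d i = d 0" for i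
  proof (induction i rule: int_induct[where k = 0])
    case (step2 i)
    then show ?case
      using d_step[of "i - 1"] by simp
  qed (simp_all add: d_step)
  then show ?thesis
    using that[of u "d 0"] u u_ne d u_d e_d by metis
qed

text \<open>The converse of \<open>billiard_contacts\<close>. Distinctness is assumed for the lines
  as point sets, the form in which \<open>Sdef\<close> provides it.\<close>

lemma billiard_of_progression:
  assumes v: "\<And>n. v n \<in> carrier (jac m)" and w: "w \<in> carrier (jac m)"
    and v_w: "\<And>n. v (n + 1) = v n \<otimes>\<^bsub>jac m\<^esub> w"
    and lines: "\<And>n. tline a b (v n) \<noteq> tline a b (v (n + 1))"
    and e: "ellipse_of b w = Some k"
  shows "billiard a b k (\<lambda>n. dehom (cross (tcoord a b (v n)) (tcoord a b (v (n + 1)))))"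
proof -
  let ?c = "\<lambda>n. cross (tcoord a b (v n)) (tcoord a b (v (n + 1)))"
  let ?S = "\<lambda>n. dehom (?c n)"
  note e' = ellipse_of_eq_Some[OF w e]
  have v_ne: "v n \<noteq> v (n + 1)" for n
    using lines by metis
  \<comment> \<open>The value 0 would force w to be the identity, so that consecutive tangents
    coincide.\<close>
  have "k \<noteq> 0"
  proof
    assume "k = 0"
    then have "cn w = cn \<one>\<^bsub>jac m\<^esub>"
      using e b_pos by (simp add: ellipse_of_def jac_def split: if_splits)
    then have "w = \<one>\<^bsub>jac m\<^esub>"
      using jac_eq_or_inv[OF w jac.one_closed] by auto
    then show False
      using v_ne[of 0] v_w[of 0] v by simp
  qed
  then have k: "0 < k"
    using e'(5) by simp
  have on_k: "on_gconic a b (Some k) (?c n)" for n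
  proof -
    have "v n \<otimes>\<^bsub>jac m\<^esub> inv\<^bsub>jac m\<^esub> v (n + 1) = inv\<^bsub>jac m\<^esub> w"
      using v w v_w[of n] by (simp add: jac.div_mult_cancel)
    then show ?thesis
      using tangents_meet_on_ellipse[OF v[of n] v[of "n + 1"]] ellipse_of_inv[OF w] e by simp
  qed
  \<comment> \<open>At a point at infinity the equation of the ellipse makes a positive definite
    form vanish, so the two tangents would have equal \<open>sn\<close> and
    \<open>cn\<close>.\<close>
  have definite: "x = 0 \<and> y = 0" if "0 < p" "0 < q" "p * x\<^sup>2 + q * y\<^sup>2 = 0" for p q x y :: real
    using that by (simp add: add_nonneg_eq_0_iff)
  have finite: "snd (snd (?c n)) \<noteq> 0" for n
  proof
    assume "snd (snd (?c n)) = 0"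
    then have Z: "sn (v n) * cn (v (n + 1)) - sn (v (n + 1)) * cn (v n) = 0"
      using a_pos b_pos by (simp add: cross_def tcoord_def field_simps)
    have "0 < (a\<^sup>2 + k) / a\<^sup>2" "0 < (b\<^sup>2 + k) / b\<^sup>2"
      using k a_pos b_pos by (simp_all add: add_pos_nonneg)
    then have "cn (v (n + 1)) - cn (v n) = 0 \<and> sn (v n) - sn (v (n + 1)) = 0"
      using on_k[of n] unfolding on_gconic_cross Z 
      by (intro definite[of "(b\<^sup>2 + k) / b\<^sup>2" "(a\<^sup>2 + k) / a\<^sup>2"]) auto
    then show False
      using jac_eqI[OF v v] v_ne by force
  qed
  have S: "?S n \<in> tline a b (v n)" "?S n \<in> tline a b (v (n + 1))" for n
    using dehom_cross_tcoord[OF finite] by blast+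
  have on_conf: "?S n \<in> conf a b k" for n
  proof -
    obtain r where "r \<noteq> 0" "?c n = scale r (hom (?S n))"
      using cross_tcoord[OF v v v_ne S] by blast
    then show ?thesis
      using on_k[of n] on_gconic_scale on_gconic_hom_iff_conf k by (metis less_imp_le)
  qed
  \<comment> \<open>A repeated vertex would lie on three consecutive tangents, so v n = v (n + 2)
    and w + w is the identity. As \<open>ellipse_of\<close> is finite at w, w is not the half
    period, hence it is the identity.\<close>
  have S_ne: "?S n \<noteq> ?S (n + 1)" for n
  proof
    assume eq: "?S n = ?S (n + 1)"
    have "v n = v (n + 1 + 1)"
      using at_most_two_tangents[of "v n" "v (n + 1)" "v (n + 1 + 1)" "?S n"] v v_ne
        S[of n] S[of "n + 1", folded eq] by blast
    moreover have "v (n + 1 + 1) = v n \<otimes>\<^bsub>jac m\<^esub> (w \<otimes>\<^bsub>jac m\<^esub> w)"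
      by (metis v w v_w jac.m_assoc)
    ultimately have "v n \<otimes>\<^bsub>jac m\<^esub> (w \<otimes>\<^bsub>jac m\<^esub> w) = v n"
      by metis
    then have "w \<otimes>\<^bsub>jac m\<^esub> w = \<one>\<^bsub>jac m\<^esub>"
      using v w by simp
    then have "w = \<one>\<^bsub>jac m\<^esub>"
      by (rule jac_double_eq_one[OF w]) (use e'(3) in simp)
    then show False
      using v_ne[of n] v_w[of n] v by simp
  qed
  have side: "aline (?S n) (?S (n + 1)) = tline a b (v (n + 1))" for n
    using aline_eq_tline[OF v S_ne S(2) S(1)] .
  show ?thesis
    unfolding billiard_def
  proof (intro conjI allI)
    fix n
    show "?S (n + 1) \<noteq> ?S n"
      using S_ne by metis
    show "tangent_to (conf a b 0) (?S n) (?S (n + 1))"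
      using tangent_toI[OF v S_ne S(2) S(1)] .
    show "aline (?S (n - 1)) (?S n) \<noteq> aline (?S n) (?S (n + 1))"
      using side[of "n - 1"] side[of n] lines[of n] by simp
  qed (use k on_conf in auto)
qed

section \<open>Intersections of the sides of a billiard\<close>

lemma Spt_eq_scale_cross:
  assumes "\<And>i. P i \<in> tline a b (u i)" "\<And>i. P (i + 1) \<in> tline a b (u i)"
    and "\<And>i. P (i + 1) \<noteq> P i"
  shows "\<exists>r. r \<noteq> 0 \<and> Spt P j i = scale r (cross (tcoord a b (u (sfst j i))) (tcoord a b (u (ssnd j i))))"
proof -
  have "\<exists>r. r \<noteq> 0 \<and> hline (P i) (P (i + 1)) = scale r (tcoord a b (u i))" for i
    using hline_eq_scale_tcoord[OF assms(3)[symmetric] assms(1,2)] .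
  then obtain r where "r i \<noteq> 0" "hline (P i) (P (i + 1)) = scale (r i) (tcoord a b (u i))" for i
    by metis
  then show ?thesis
    by (intro exI[of _ "r (sfst j i) * r (ssnd j i)"]) (simp add: Spt_def meet_def cross_scale)
qed

end

lemma confocalI:
  assumes "0 < b" "b < a"
  shows "confocal (1 - b\<^sup>2 / a\<^sup>2) a b"
proof
  have "b\<^sup>2 < a\<^sup>2"
    using assms by (simp add: power_strict_mono)
  then show "0 < 1 - b\<^sup>2 / a\<^sup>2"
    using assms by simp
qed (use assms in simp_all)

text \<open>For either parity the two tangents through S_i^(j) differ by j + 1 steps, independently
  of i; this is the source of the ellipse e^(j).\<close>

lemma ssnd_eq: "ssnd j i = sfst j i + int (j + 1)"
proof (cases "even j")
  case True
  then obtain k where "j = 2 * k" ..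
  then show ?thesis
    by (simp add: ssnd_def sfst_def)
next
  case False
  then obtain k where "j = 2 * k + 1" ..
  then show ?thesis
    by (simp add: ssnd_def sfst_def)
qed

theorem theorem3p6:
  fixes ac bc ke :: real
  assumes "ac > bc" and "bc > 0" and "ke > 0"
  shows
   "(\<forall>P Q. billiard ac bc ke P \<and> (\<forall>i. Q i \<in> conf ac bc 0 \<and> Q i \<in> aline (P i) (P (i + 1))) \<longrightarrow>
       (\<forall>i.
         (\<exists>k. - (ac\<^sup>2) \<le> k \<and> k \<le> - (bc\<^sup>2) \<and> on_gconic ac bc (Some k) (hom (Q i)) \<and>
              (\<forall>j. odd j \<and> Sdef P j i \<longrightarrow> on_gconic ac bc (Some k) (Spt P j i))) \<and>
         (\<exists>k. - (ac\<^sup>2) \<le> k \<and> k \<le> - (bc\<^sup>2) \<and> on_gconic ac bc (Some k) (hom (P i)) \<and>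
              (\<forall>j. even j \<and> j \<ge> 2 \<and> Sdef P j i \<longrightarrow> on_gconic ac bc (Some k) (Spt P j i)))))
    \<and> (\<forall>j::nat. j \<ge> 1 \<longrightarrow>
         (\<exists>E. admissible ac E \<and>
            (\<forall>P. billiard ac bc ke P \<longrightarrow> (\<forall>i. Sdef P j i \<longrightarrow> on_gconic ac bc E (Spt P j i))) \<and>
            (\<forall>k. E = Some k \<and> k > - (bc\<^sup>2) \<longrightarrow>
               (\<forall>P. billiard ac bc ke P \<and> (\<forall>i. Sdef P j i) \<longrightarrow>
                  (\<forall>i. billiard ac bc k (\<lambda>m. dehom (Spt P j (i + m * (int j + 1)))))))))"
proof -
  define m where "m = 1 - bc\<^sup>2 / ac\<^sup>2"
  interpret confocal m ac bc
    unfolding m_def by (rule confocalI[OF assms(2,1)])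
  have side: "aline (P i) (P (i + 1)) = tline ac bc (u i)"
    if "\<And>i. u i \<in> carrier (jac m)" "\<And>i. P i \<in> tline ac bc (u i)"
      "\<And>i. P (i + 1) \<in> tline ac bc (u i)" "billiard ac bc ke P" for u P i
    using aline_eq_tline[of "u i" "P i" "P (i + 1)"] that by (metis billiard_def)

  have 1: "(\<exists>k. - (ac\<^sup>2) \<le> k \<and> k \<le> - (bc\<^sup>2) \<and> on_gconic ac bc (Some k) (hom (Q i)) \<and>
              (\<forall>j. odd j \<and> Sdef P j i \<longrightarrow> on_gconic ac bc (Some k) (Spt P j i))) \<and>
         (\<exists>k. - (ac\<^sup>2) \<le> k \<and> k \<le> - (bc\<^sup>2) \<and> on_gconic ac bc (Some k) (hom (P i)) \<and>
              (\<forall>j. even j \<and> j \<ge> 2 \<and> Sdef P j i \<longrightarrow> on_gconic ac bc (Some k) (Spt P j i)))"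
    if P: "billiard ac bc ke P" and Q: "\<forall>i. Q i \<in> conf ac bc 0 \<and> Q i \<in> aline (P i) (P (i + 1))"
    for P Q i
  proof -
    obtain u d where u: "\<And>i. u i \<in> carrier (jac m)" and d: "d \<in> carrier (jac m)"
      and u_d: "\<And>i. u (i + 1) = u i \<otimes>\<^bsub>jac m\<^esub> d" and u_ne: "\<And>i. u (i + 1) \<noteq> u i"
      and P_on: "\<And>i. P i \<in> tline ac bc (u i)" "\<And>i. P (i + 1) \<in> tline ac bc (u i)"
      using billiard_contacts[OF P] by metis
    \<comment> \<open>Used with k = l = i for odd j, where Q i is the contact point of side i, and
      with k = i - 1, l = i for even j, where P i is the intersection of these two sides.\<close>
    have S: "on_gconic ac bc (Some (hyperbola_of ac bc (u k \<otimes>\<^bsub>jac m\<^esub> u l))) (Spt P j i)"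
      if "sfst j i + ssnd j i = k + l" for j k l
    proof -
      have "\<exists>r. r \<noteq> 0 \<and> Spt P j i =
          scale r (cross (tcoord ac bc (u (sfst j i))) (tcoord ac bc (u (ssnd j i))))"
        using Spt_eq_scale_cross[of P u, OF P_on] P by (auto simp: billiard_def)
      then show ?thesis
        using tangents_meet_on_hyperbola[OF u u, of "sfst j i" "ssnd j i"]
          jac.arithmetic_progression_sum[of u d, OF u d u_d that] on_gconic_scale by metis
    qed
    have "Q i = (ac * sn (u i), bc * cn (u i))"
      using Q side[OF u P_on P] conf_0_inter_tline[OF u] by blast
    then have "on_gconic ac bc (Some (hyperbola_of ac bc (u i \<otimes>\<^bsub>jac m\<^esub> u i))) (hom (Q i))"
      using contact_on_hyperbola[OF u] by (simp add: hom_def)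
    moreover have "sfst j i + ssnd j i = i + i" if "odd j" for j
      using that by (simp add: sfst_def ssnd_def)
    moreover have "on_gconic ac bc (Some (hyperbola_of ac bc (u (i - 1) \<otimes>\<^bsub>jac m\<^esub> u i))) (hom (P i))"
    proof -
      have "\<exists>r. r \<noteq> 0 \<and> cross (tcoord ac bc (u (i - 1))) (tcoord ac bc (u i)) = scale r (hom (P i))"
        using cross_tcoord[of "u (i - 1)" "u i" "P i"] u u_ne[of "i - 1"] P_on(1)[of i]
          P_on(2)[of "i - 1"] by simp
      then show ?thesis
        using tangents_meet_on_hyperbola[OF u u, of "i - 1" i] on_gconic_scale by metis
    qed
    moreover have "sfst j i + ssnd j i = (i - 1) + i" if "even j" for j
      using that by (simp add: sfst_def ssnd_def)
    ultimately show ?thesis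
      using S hyperbola_of_bounds jac.m_closed[OF u u] by meson
  qed

  have 2: "\<exists>E. admissible ac E \<and>
      (\<forall>P. billiard ac bc ke P \<longrightarrow> (\<forall>i. Sdef P j i \<longrightarrow> on_gconic ac bc E (Spt P j i))) \<and>
      (\<forall>k. E = Some k \<and> k > - (bc\<^sup>2) \<longrightarrow>
         (\<forall>P. billiard ac bc ke P \<and> (\<forall>i. Sdef P j i) \<longrightarrow>
            (\<forall>i. billiard ac bc k (\<lambda>m. dehom (Spt P j (i + m * (int j + 1)))))))" for j
  \<comment> \<open>The conic is chosen before the billiard, so its step is taken from some fixed
    billiard. If there is none, the claims are vacuous and the line at infinity serves as
    default.\<close>
  proof (cases "\<exists>P. billiard ac bc ke P")
    case False
    then show ?thesis
      by (intro exI[of _ None]) (simp add: admissible_def)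
  next
    case True
    then obtain d0 where d0: "d0 \<in> carrier (jac m)" "ellipse_of bc d0 = Some ke"
      using billiard_contacts by metis
    let ?n = "int (j + 1)"
    define E where "E = ellipse_of bc (d0 [^]\<^bsub>jac m\<^esub> ?n)"
    have "admissible ac E"
    proof (cases E)
      case (Some k)
      then have "0 \<le> k"
        using ellipse_of_eq_Some(5)[of "d0 [^]\<^bsub>jac m\<^esub> ?n" k] d0(1) by (simp add: E_def)
      then show ?thesis
        using Some by (simp add: admissible_def order_trans[of _ 0])
    qed (simp add: admissible_def)
    moreover have "(Sdef P j i \<longrightarrow> on_gconic ac bc E (Spt P j i)) \<and>
      (\<forall>k. E = Some k \<and> (\<forall>i. Sdef P j i) \<longrightarrow>
        billiard ac bc k (\<lambda>m. dehom (Spt P j (i + m * (int j + 1)))))"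
      if P: "billiard ac bc ke P" for P i
    proof -
      obtain u d where u: "\<And>i. u i \<in> carrier (jac m)" and d: "d \<in> carrier (jac m)"
        and u_d: "\<And>i. u (i + 1) = u i \<otimes>\<^bsub>jac m\<^esub> d"
        and P_on: "\<And>i. P i \<in> tline ac bc (u i)" "\<And>i. P (i + 1) \<in> tline ac bc (u i)"
        and e_d: "ellipse_of bc d = Some ke"
        using billiard_contacts[OF P] by metis
      define w where "w = d [^]\<^bsub>jac m\<^esub> ?n"
      have w: "w \<in> carrier (jac m)"
        using d by (simp add: w_def)
      \<comment> \<open>Any billiard in e has the step d0 or its inverse, and
        \<open>ellipse_of\<close> does not distinguish inverse elements. So E is independent of the
        billiard.\<close>
      have "d = d0 \<or> d = inv\<^bsub>jac m\<^esub> d0"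
        using jac_eq_or_inv[OF d d0(1)] ellipse_of_inj[OF d d0(1) e_d d0(2)] by blast
      then have e_w: "ellipse_of bc w = E"
        using d0(1) ellipse_of_inv[OF jac.int_pow_closed[OF d0(1)]]
        by (auto simp: w_def E_def jac.int_pow_inv)
      have u_w: "u (i + ?n) = u i \<otimes>\<^bsub>jac m\<^esub> w" for i
        using jac.arithmetic_progression[of u d, OF u d u_d] by (simp add: w_def)
      have Spt: "\<exists>r. r \<noteq> 0 \<and> Spt P j i =
          scale r (cross (tcoord ac bc (u (sfst j i))) (tcoord ac bc (u (sfst j i + ?n))))" for i
        using Spt_eq_scale_cross[of P u, OF P_on] P unfolding ssnd_eq by (auto simp: billiard_def)
      have "on_gconic ac bc E (Spt P j i)"
        using Spt tangents_meet_on_ellipse[OF u u, of "sfst j i" "sfst j i + ?n"] u w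
        by (metis u_w jac.div_mult_cancel ellipse_of_inv e_w on_gconic_scale)
      moreover have "billiard ac bc k (\<lambda>m. dehom (Spt P j (i + m * (int j + 1))))"
        if k: "E = Some k" and S: "\<forall>i. Sdef P j i" for k
      proof -
        \<comment> \<open>Raising the index of S by j + 1 shifts both sides by j + 1, so the second
          side of one point is the first side of the next. The first sides form a progression with
          step w.\<close>
        define v where "v n = u (sfst j i + n * ?n)" for n
        have idx: "sfst j (i + n * (int j + 1)) = sfst j i + n * ?n" for n
          by (simp add: sfst_def)
        have v_Suc: "v (n + 1) = u (sfst j i + n * ?n + ?n)" for n
          by (simp add: v_def algebra_simps)
        have "tline ac bc (v n) \<noteq> tline ac bc (v (n + 1))" for n
          using S[rule_format, of "i + n * (int j + 1)"]
          unfolding Sdef_def ssnd_eq side[OF u P_on P] idx v_Suc by (simp add: v_def)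
        then have "billiard ac bc k (\<lambda>n. dehom (cross (tcoord ac bc (v n)) (tcoord ac bc (v (n + 1)))))"
          using billiard_of_progression[of v w k] u w u_w v_Suc e_w k by (simp add: v_def)
        moreover have "dehom (Spt P j (i + n * (int j + 1)))
            = dehom (cross (tcoord ac bc (v n)) (tcoord ac bc (v (n + 1))))" for n
          using Spt[of "i + n * (int j + 1)"] unfolding idx v_Suc unfolding v_def
          using dehom_scale by metis
        ultimately show ?thesis
          by simp
      qed
      ultimately show ?thesis
        by blast
    qed
    ultimately show ?thesis
      by (intro exI[of _ E]) blast
  qed
  show ?thesis
    using 1 2 by blast
qed

end
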